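(* Let $n\ge1$. Let $V(K)\subset\mathbf{P}^{n+2}$ be the Klein hypersurface of dimension $n+1$ and degree $d\ge3$, and let $V(K')\subset\mathbf{P}^{n+2}$ be the reverse-order Klein hypersurface of degree $d'\ge2$. Set $$m=\frac{(d-1)^{n+3}-(-1)^{n+3}}{d},\qquad G=(\mathbf{Z}/m\mathbf{Z})\rtimes(\mathbf{Z}/(n+3)\mathbf{Z}),$$ where $G\subseteq\operatorname{PGL}(V)$ is generated by the diagonal automorphism $\varphi_0=\operatorname{diag}(\zeta_m^{\sigma_0},\dots,\zeta_m^{\sigma_{n+2}})$ with $\sigma_j=(1-d)^j$, and the cyclic permutation $\nu\colon(x_0:\cdots:x_{n+2})\mapsto(x_1:\cdots:x_{n+2}:x_0)$. If $(d-1)(d'-1)\equiv1\pmod m$, then $d'>d$ and $$G\subseteq\operatorname{Aut}(V(K))\cap\operatorname{Aut}(V(K')).$$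
   Context: We work over $\mathbf{C}$. $V$ is a complex vector space of dimension $n+3$ with $\mathbf{P}(V)=\mathbf{P}^{n+2}$, and $x_0,\dots,x_{n+2}$ are the homogeneous coordinates given by a fixed basis of $V$; $\operatorname{PGL}(V)$ is the automorphism group of $\mathbf{P}^{n+2}$, and $\zeta_m$ denotes a primitive $m$-th root of unity. The Klein hypersurface of degree $d$ and the reverse-order Klein hypersurface of degree $d'$ are the zero loci of $$K=x_0^{d-1}x_1+x_1^{d-1}x_2+\cdots+x_{n+1}^{d-1}x_{n+2}+x_{n+2}^{d-1}x_0,$$ $$K'=x_1^{d'-1}x_0+x_2^{d'-1}x_1+\cdots+x_{n+2}^{d'-1}x_{n+1}+x_0^{d'-1}x_{n+2}.$$ The inclusion means that every element of $G$ preserves both hypersurfaces $V(K)$ and $V(K')$.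
   Formalization: G is taken as the subgroup of PGL(V) generated by φ_0 and ν; its description as (Z/m)⋊(Z/(n+3)) is not asserted, since it fails when gcd(d,n+3)>1 (for n=3, d=3, m=21, φ_0^7 is scalar), G then being only a quotient. *)

theory Defs
  imports
    "HOL-Algebra.Generated_Groups"
    "HOL-Number_Theory.Cong"
    "Jordan_Normal_Form.Matrix"
begin

section \<open>Projective space and the projective linear group\<close>

text \<open>The space \<open>V\<close> with its fixed basis is \<open>carrier_vec N\<close>, where \<open>N = dim V\<close>; coordinates and
  matrix entries are indexed from \<open>0\<close>. A point of \<open>P(V)\<close> is represented by the set of all its
  (nonzero) homogeneous coordinate vectors, so that \<open>proj_space N\<close> has dimension \<open>N - 1\<close>.\<close>

definition proj_point :: "complex vec \<Rightarrow> complex vec set" where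
  "proj_point v = {c \<cdot>\<^sub>v v | c. c \<noteq> 0}"

definition proj_space :: "nat \<Rightarrow> complex vec set set" where
  "proj_space N = proj_point ` (carrier_vec N - {0\<^sub>v N})"

text \<open>Meant for homogeneous \<open>F\<close>, where the condition does not depend on the representative.\<close>

definition zero_locus :: "nat \<Rightarrow> (complex vec \<Rightarrow> complex) \<Rightarrow> complex vec set set" where
  "zero_locus N F = {p \<in> proj_space N. \<forall>x\<in>p. F x = 0}"

definition GL :: "nat \<Rightarrow> complex mat monoid" where
  "GL N = units_of (ring_mat TYPE(complex) N ())"

definition scalar_mats :: "nat \<Rightarrow> complex mat set" where
  "scalar_mats N = {c \<cdot>\<^sub>m 1\<^sub>m N | c. c \<noteq> 0}"

definition PGL :: "nat \<Rightarrow> complex mat set monoid" where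
  "PGL N = GL N Mod scalar_mats N"

definition proj_class :: "nat \<Rightarrow> complex mat \<Rightarrow> complex mat set" where
  "proj_class N A = scalar_mats N #>\<^bsub>GL N\<^esub> A"

text \<open>Elements of \<open>PGL N\<close> are cosets of matrices; they act on points by \<open>[A][x] = [A x]\<close>
  (see \<open>proj_act_class\<close> below).\<close>

definition proj_act :: "complex mat set \<Rightarrow> complex vec set \<Rightarrow> complex vec set" where
  "proj_act g p = {A *\<^sub>v x | A x. A \<in> g \<and> x \<in> p}"

text \<open>For a hypersurface \<open>X\<close> this is the group of projective transformations preserving \<open>X\<close>.\<close>

definition proj_Aut :: "nat \<Rightarrow> complex vec set set \<Rightarrow> complex mat set set" where
  "proj_Aut N X = {g \<in> carrier (PGL N). proj_act g ` X = X}"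


section \<open>Klein hypersurfaces and the group generated by \<open>\<phi>\<^sub>0\<close> and \<open>\<nu>\<close>\<close>

definition klein_form :: "nat \<Rightarrow> nat \<Rightarrow> complex vec \<Rightarrow> complex" where
  "klein_form n d x = (\<Sum>i<n+2. (x $ i) ^ (d - 1) * x $ (i + 1)) + (x $ (n+2)) ^ (d - 1) * x $ 0"

definition rev_klein_form :: "nat \<Rightarrow> nat \<Rightarrow> complex vec \<Rightarrow> complex" where
  "rev_klein_form n d x = (\<Sum>i<n+2. (x $ (i + 1)) ^ (d - 1) * x $ i) + (x $ 0) ^ (d - 1) * x $ (n+2)"

definition klein_hypersurface :: "nat \<Rightarrow> nat \<Rightarrow> complex vec set set" where
  "klein_hypersurface n d = zero_locus (n+3) (klein_form n d)"

definition rev_klein_hypersurface :: "nat \<Rightarrow> nat \<Rightarrow> complex vec set set" where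
  "rev_klein_hypersurface n d = zero_locus (n+3) (rev_klein_form n d)"

text \<open>The division is exact, see \<open>klein_m_exact\<close> below.\<close>

definition klein_m :: "nat \<Rightarrow> nat \<Rightarrow> nat" where
  "klein_m n d = nat (((int d - 1) ^ (n+3) - (-1) ^ (n+3)) div int d)"

definition primitive_root_of_unity :: "nat \<Rightarrow> complex \<Rightarrow> bool" where
  "primitive_root_of_unity m \<zeta> \<longleftrightarrow> \<zeta> ^ m = 1 \<and> (\<forall>k. 0 < k \<and> k < m \<longrightarrow> \<zeta> ^ k \<noteq> 1)"

definition phi0_mat :: "nat \<Rightarrow> nat \<Rightarrow> complex \<Rightarrow> complex mat" where
  "phi0_mat n d \<zeta> = mat_diag (n+3) (\<lambda>j. \<zeta> powi ((1 - int d) ^ j))"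

text \<open>The matrix of \<open>(x\<^sub>0, \<dots>, x\<^sub>n\<^sub>+\<^sub>2) \<mapsto> (x\<^sub>1, \<dots>, x\<^sub>n\<^sub>+\<^sub>2, x\<^sub>0)\<close>, see \<open>nu_mat_apply\<close> below.\<close>

definition nu_mat :: "nat \<Rightarrow> complex mat" where
  "nu_mat n = mat (n+3) (n+3) (\<lambda>(i, j). if j = (i + 1) mod (n+3) then 1 else 0)"

definition klein_group :: "nat \<Rightarrow> nat \<Rightarrow> complex \<Rightarrow> complex mat set set" where
  "klein_group n d \<zeta> =
     generate (PGL (n+3)) {proj_class (n+3) (phi0_mat n d \<zeta>), proj_class (n+3) (nu_mat n)}"


section \<open>Consistency of the definitions\<close>

lemma GL_simps:
  "monoid.mult (GL N) = (*)" "one (GL N) = 1\<^sub>m N"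
  by (simp_all add: GL_def units_of_def ring_mat_simps)

lemma GL_group: "group (GL N)"
proof -
  interpret ring "ring_mat TYPE(complex) N ()" by (rule ring_mat)
  show ?thesis unfolding GL_def by (rule units_group)
qed

lemma carrier_GL:
  "A \<in> carrier (GL N) \<longleftrightarrow>
     A \<in> carrier_mat N N \<and> (\<exists>B\<in>carrier_mat N N. B * A = 1\<^sub>m N \<and> A * B = 1\<^sub>m N)"
  by (auto simp: GL_def units_of_def Units_def ring_mat_simps)

lemma smult_one_mult:
  assumes "(A :: complex mat) \<in> carrier_mat N N"
  shows "(c \<cdot>\<^sub>m 1\<^sub>m N) * A = c \<cdot>\<^sub>m A" "A * (c \<cdot>\<^sub>m 1\<^sub>m N) = c \<cdot>\<^sub>m A"
  using assms by (auto simp: mult_smult_distrib mult_smult_assoc_mat)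

lemma scalar_mult_scalar:
  "(c \<cdot>\<^sub>m 1\<^sub>m N) * (e \<cdot>\<^sub>m 1\<^sub>m N) = ((c * e) \<cdot>\<^sub>m 1\<^sub>m N :: complex mat)"
  by (subst smult_one_mult) (auto intro!: eq_matI)

lemma scalar_mats_sub: "scalar_mats N \<subseteq> carrier (GL N)"
proof
  fix A assume "A \<in> scalar_mats N"
  then obtain c where c: "c \<noteq> 0" "A = c \<cdot>\<^sub>m 1\<^sub>m N" by (auto simp: scalar_mats_def)
  then show "A \<in> carrier (GL N)"
    unfolding carrier_GL
    by (auto intro!: bexI[of _ "inverse c \<cdot>\<^sub>m 1\<^sub>m N"] eq_matI simp: scalar_mult_scalar)
qed

lemma scalar_mats_normal: "scalar_mats N \<lhd> GL N"
proof -
  interpret G: group "GL N" by (rule GL_group)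
  have scalar_GL: "c \<cdot>\<^sub>m 1\<^sub>m N \<in> carrier (GL N)" if "c \<noteq> 0" for c
  proof -
    have "c \<cdot>\<^sub>m 1\<^sub>m N \<in> scalar_mats N" unfolding scalar_mats_def using that by blast
    then show ?thesis using scalar_mats_sub by blast
  qed
  have inv: "inv\<^bsub>GL N\<^esub> (c \<cdot>\<^sub>m 1\<^sub>m N) = inverse c \<cdot>\<^sub>m 1\<^sub>m N" if "c \<noteq> 0" for c
  proof (rule G.inv_equality)
    show "inverse c \<cdot>\<^sub>m 1\<^sub>m N \<otimes>\<^bsub>GL N\<^esub> (c \<cdot>\<^sub>m 1\<^sub>m N) = \<one>\<^bsub>GL N\<^esub>"
      using that by (auto simp: GL_simps scalar_mult_scalar intro!: eq_matI)
    show "c \<cdot>\<^sub>m 1\<^sub>m N \<in> carrier (GL N)" "inverse c \<cdot>\<^sub>m 1\<^sub>m N \<in> carrier (GL N)"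
      using that by (simp_all add: scalar_GL)
  qed
  have sub: "subgroup (scalar_mats N) (GL N)"
  proof (rule G.subgroupI)
    show "scalar_mats N \<subseteq> carrier (GL N)" by (rule scalar_mats_sub)
    show "scalar_mats N \<noteq> {}" by (auto simp: scalar_mats_def intro: exI[of _ 1])
    show "inv\<^bsub>GL N\<^esub> A \<in> scalar_mats N" if "A \<in> scalar_mats N" for A
    proof -
      from that obtain c where "c \<noteq> 0" "A = c \<cdot>\<^sub>m 1\<^sub>m N" by (auto simp: scalar_mats_def)
      then show ?thesis unfolding scalar_mats_def using inv[of c]
        by (auto intro!: exI[of _ "inverse c"])
    qed
    show "A \<otimes>\<^bsub>GL N\<^esub> B \<in> scalar_mats N" if AB: "A \<in> scalar_mats N" "B \<in> scalar_mats N" for A B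
    proof -
      from AB obtain c e where "c \<noteq> 0" "A = c \<cdot>\<^sub>m 1\<^sub>m N" "e \<noteq> 0" "B = e \<cdot>\<^sub>m 1\<^sub>m N"
        by (auto simp: scalar_mats_def)
      then show ?thesis
        by (auto simp: scalar_mats_def GL_simps scalar_mult_scalar intro!: exI[of _ "c * e"])
    qed
  qed
  show ?thesis
  proof (rule G.normalI[OF sub], rule ballI)
    fix A assume "A \<in> carrier (GL N)"
    then have A: "A \<in> carrier_mat N N" by (simp add: carrier_GL)
    show "scalar_mats N #>\<^bsub>GL N\<^esub> A = A <#\<^bsub>GL N\<^esub> scalar_mats N"
      using smult_one_mult[OF A]
      by (auto simp: r_coset_def l_coset_def scalar_mats_def GL_simps)
  qed
qed

lemma PGL_group: "group (PGL N)"
  unfolding PGL_def by (rule normal.factorgroup_is_group[OF scalar_mats_normal])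

lemma proj_class_eq:
  "A \<in> carrier_mat N N \<Longrightarrow> proj_class N A = {c \<cdot>\<^sub>m A | c. c \<noteq> 0}"
  unfolding proj_class_def r_coset_def scalar_mats_def GL_simps
  by (auto simp: smult_one_mult(1))

lemma proj_class_in_PGL: "A \<in> carrier (GL N) \<Longrightarrow> proj_class N A \<in> carrier (PGL N)"
  by (auto simp: proj_class_def PGL_def carrier_FactGroup)

lemma proj_class_mult:
  "\<lbrakk>A \<in> carrier (GL N); B \<in> carrier (GL N)\<rbrakk> \<Longrightarrow>
     proj_class N A \<otimes>\<^bsub>PGL N\<^esub> proj_class N B = proj_class N (A * B)"
  unfolding proj_class_def PGL_def mult_FactGroup GL_simps(1)[of N, symmetric]
  by (rule normal.rcos_sum[OF scalar_mats_normal])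

lemma proj_class_one: "proj_class N (1\<^sub>m N) = \<one>\<^bsub>PGL N\<^esub>"
  by (auto simp: proj_class_eq PGL_def scalar_mats_def)

lemma proj_act_class:
  assumes A: "A \<in> carrier_mat N N" and x: "x \<in> carrier_vec N"
  shows "proj_act (proj_class N A) (proj_point x) = proj_point (A *\<^sub>v x)"
proof -
  have *: "(c \<cdot>\<^sub>m A) *\<^sub>v (e \<cdot>\<^sub>v x) = (c * e) \<cdot>\<^sub>v (A *\<^sub>v x)" for c e
    using A x by (auto intro!: eq_vecI simp: scalar_prod_def sum_distrib_left ac_simps)
  show ?thesis
    unfolding proj_act_def proj_point_def proj_class_eq[OF A]
  proof safe
    fix c e :: complex assume "c \<noteq> 0" "e \<noteq> 0"
    then show "\<exists>f. (c \<cdot>\<^sub>m A) *\<^sub>v (e \<cdot>\<^sub>v x) = f \<cdot>\<^sub>v (A *\<^sub>v x) \<and> f \<noteq> 0"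
      unfolding * by (intro exI[of _ "c * e"]) auto
  next
    fix c :: complex assume "c \<noteq> 0"
    then show "\<exists>B y. c \<cdot>\<^sub>v (A *\<^sub>v x) = B *\<^sub>v y \<and> B \<in> {c \<cdot>\<^sub>m A |c. c \<noteq> 0} \<and>
        y \<in> {c \<cdot>\<^sub>v x |c. c \<noteq> 0}"
      using *[of c 1] by (intro exI[of _ "c \<cdot>\<^sub>m A"] exI[of _ "1 \<cdot>\<^sub>v x"]) (auto intro: exI[of _ 1])
  qed
qed

lemma klein_form_smult:
  assumes "x \<in> carrier_vec (n+3)" "d \<ge> 1"
  shows "klein_form n d (c \<cdot>\<^sub>v x) = c ^ d * klein_form n d x"
    and "rev_klein_form n d (c \<cdot>\<^sub>v x) = c ^ d * rev_klein_form n d x"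
proof -
  have d: "c ^ d = c ^ (d - 1) * c" using assms(2) by (cases d) auto
  show "klein_form n d (c \<cdot>\<^sub>v x) = c ^ d * klein_form n d x"
       "rev_klein_form n d (c \<cdot>\<^sub>v x) = c ^ d * rev_klein_form n d x"
    unfolding d using assms(1)
    by (auto simp: klein_form_def rev_klein_form_def power_mult_distrib sum_distrib_left
        distrib_left ac_simps intro!: sum.cong)
qed

lemma proj_point_in_hypersurface:
  assumes "x \<in> carrier_vec (n+3)" "x \<noteq> 0\<^sub>v (n+3)" "d \<ge> 1"
  shows "proj_point x \<in> klein_hypersurface n d \<longleftrightarrow> klein_form n d x = 0"
    and "proj_point x \<in> rev_klein_hypersurface n d \<longleftrightarrow> rev_klein_form n d x = 0"
proof -
  have "proj_point x \<in> proj_space (n+3)" using assms by (auto simp: proj_space_def)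
  then show "proj_point x \<in> klein_hypersurface n d \<longleftrightarrow> klein_form n d x = 0"
    "proj_point x \<in> rev_klein_hypersurface n d \<longleftrightarrow> rev_klein_form n d x = 0"
    by (auto simp: klein_hypersurface_def rev_klein_hypersurface_def zero_locus_def proj_point_def
        klein_form_smult[OF assms(1,3)] intro: exI[of _ 1])
qed

lemma nu_mat_apply:
  assumes "x \<in> carrier_vec (n+3)"
  shows "nu_mat n *\<^sub>v x = vec (n+3) (\<lambda>i. x $ ((i + 1) mod (n+3)))"
  using assms
  by (auto intro!: eq_vecI simp: nu_mat_def scalar_prod_def if_distrib[of "\<lambda>c. c * _"] sum.delta cong: if_cong)

lemma power_pred_expand:
  "\<exists>k::int. (int d - 1) ^ N = (-1) ^ N - int N * int d * (-1) ^ N + k * int d ^ 2"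
proof (induction N)
  case (Suc N)
  then obtain k where k: "(int d - 1) ^ N = (-1) ^ N - int N * int d * (-1) ^ N + k * int d ^ 2" ..
  show ?case
    by (rule exI[of _ "k * (int d - 1) - int N * (-1) ^ N"])
      (simp add: k algebra_simps power2_eq_square)
qed (auto intro: exI[of _ 0])

lemma klein_m_exact:
  assumes "d \<ge> 2"
  shows "int d * int (klein_m n d) = (int d - 1) ^ (n+3) - (-1) ^ (n+3)"
proof -
  let ?t = "(int d - 1) ^ (n+3) - (-1) ^ (n+3)"
  obtain k where k: "(int d - 1) ^ (n+3) =
      (-1) ^ (n+3) - int (n+3) * int d * (-1) ^ (n+3) + k * int d ^ 2"
    using power_pred_expand by blast
  have "?t = int d * (k * int d - int (n+3) * (-1) ^ (n+3))"
    unfolding k by (simp add: algebra_simps power2_eq_square)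
  then have dvd: "int d dvd ?t" by (metis dvd_triv_left)
  have "(-1 :: int) ^ (n+3) \<le> 1" by (cases "even (n+3)") (simp_all only: power_minus_odd power_minus_even, simp_all)
  moreover have "(int d - 1) ^ (n+3) \<ge> 1" using assms by (intro one_le_power) auto
  ultimately have "?t \<ge> 0" by linarith
  then have "?t div int d \<ge> 0" using assms by (simp add: pos_imp_zdiv_nonneg_iff)
  then show ?thesis using dvd by (simp add: klein_m_def)
qed

lemma klein_m_pos:
  assumes "d \<ge> 3"
  shows "klein_m n d > 0"
proof -
  have "(-1 :: int) ^ (n+3) \<le> 1" by (cases "even (n+3)") simp_all
  moreover have "(int d - 1) ^ (n+3) > 1" using assms by (intro one_less_power) auto
  ultimately have "int d * int (klein_m n d) > 0" using klein_m_exact[of d n] assms by linarith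
  then show ?thesis by (simp add: zero_less_mult_iff)
qed

lemma gcd_klein_m:
  assumes "d \<ge> 2"
  shows "gcd (klein_m n d) d = gcd d (n+3)"
proof -
  obtain k where k: "(int d - 1) ^ (n+3) =
      (-1) ^ (n+3) - int (n+3) * int d * (-1) ^ (n+3) + k * int d ^ 2"
    using power_pred_expand by blast
  have "int d * int (klein_m n d) = int d * (k * int d - int (n+3) * (-1) ^ (n+3))"
    unfolding klein_m_exact[OF assms] k by (simp add: algebra_simps power2_eq_square)
  then have m: "int (klein_m n d) = k * int d + (- ((-1) ^ (n+3))) * int (n+3)"
    using assms by simp
  have "gcd (int d) (int (klein_m n d)) = gcd (int d) ((- ((-1) ^ (n+3))) * int (n+3))"
    unfolding m by (rule gcd_add_mult)
  also have "\<dots> = gcd (int d) (int (n+3))"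
  proof -
    have "gcd x (e * y) = gcd x y" if "e = 1 \<or> e = -1" for e x y :: int
      using that by auto
    moreover have "- ((-1) ^ N) = (1 :: int) \<or> - ((-1) ^ N) = (-1 :: int)" for N :: nat
      by (cases "even N") simp_all
    ultimately show ?thesis by blast
  qed
  finally have "int (gcd d (klein_m n d)) = int (gcd d (n+3))" by (simp only: gcd_int_int_eq)
  then show ?thesis by (simp add: gcd.commute)
qed

lemma primitive_root_powi_eq_iff:
  assumes "primitive_root_of_unity m \<zeta>" "m > 0"
  shows "\<zeta> powi k = \<zeta> powi l \<longleftrightarrow> int m dvd k - l"
proof -
  have z: "\<zeta> \<noteq> 0" and zm: "\<zeta> powi int m = 1"
    using assms by (auto simp: primitive_root_of_unity_def power_0_left)
  have one: "\<zeta> powi j = 1 \<longleftrightarrow> int m dvd j" for j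
  proof -
    have "\<zeta> powi j = \<zeta> powi (int m * (j div int m) + j mod int m)" by simp
    also have "\<dots> = (\<zeta> powi int m) powi (j div int m) * \<zeta> powi (j mod int m)"
      unfolding power_int_mult[symmetric] using z by (intro power_int_add) auto
    also have "\<dots> = \<zeta> powi (j mod int m)" unfolding zm by simp
    also have "\<dots> = \<zeta> ^ nat (j mod int m)"
      using assms(2) by (simp add: power_int_def)
    finally have *: "\<zeta> powi j = \<zeta> ^ nat (j mod int m)" .
    have nn: "0 \<le> j mod int m" using assms(2) by simp
    have lt: "nat (j mod int m) < m" using assms(2) by (simp add: nat_less_iff)
    have "\<zeta> ^ nat (j mod int m) = 1 \<longleftrightarrow> nat (j mod int m) = 0"
      using assms(1) lt unfolding primitive_root_of_unity_def by (metis gr0I power_0)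
    also have "\<dots> \<longleftrightarrow> int m dvd j"
      using nn by (auto simp: dvd_eq_mod_eq_0)
    finally show ?thesis using * by simp
  qed
  have "\<zeta> powi k = \<zeta> powi l \<longleftrightarrow> \<zeta> powi (k - l) = 1"
    using z by (simp add: power_int_diff)
  then show ?thesis using one by simp
qed

text \<open>The semidirect product of \<open>Z/m\<close> and \<open>Z/N\<close>, where \<open>1 \<in> Z/N\<close> acts on \<open>Z/m\<close> as
  multiplication by \<open>t\<close>; this needs \<open>t ^ N = 1\<close> in \<open>Z/m\<close>.\<close>

definition cyclic_semidirect :: "nat \<Rightarrow> nat \<Rightarrow> int \<Rightarrow> (int \<times> nat) monoid" where
  "cyclic_semidirect m N t =
     \<lparr>carrier = {0..<int m} \<times> {..<N},
      monoid.mult = (\<lambda>(a, b) (a', b'). ((a + t ^ b * a') mod int m, (b + b') mod N)),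
      one = (0, 0)\<rparr>"

lemma power_mod_exponent:
  assumes "[t ^ N = 1] (mod (m :: int))"
  shows "[t ^ (b mod N) = t ^ b] (mod m)"
proof -
  have "t ^ b = (t ^ N) ^ (b div N) * t ^ (b mod N)"
    by (simp flip: power_mult power_add)
  moreover have "[(t ^ N) ^ (b div N) * t ^ (b mod N) = 1 ^ (b div N) * t ^ (b mod N)] (mod m)"
    using assms by (intro cong_mult cong_pow cong_refl)
  ultimately show ?thesis by (simp add: cong_sym_eq)
qed

lemma cyclic_semidirect_group:
  assumes "m > 0" "N > 0" and t: "[t ^ N = 1] (mod int m)"
  shows "group (cyclic_semidirect m N t)"
proof (rule groupI)
  let ?S = "cyclic_semidirect m N t"
  note [simp] = cyclic_semidirect_def
  show "x \<otimes>\<^bsub>?S\<^esub> y \<in> carrier ?S" if "x \<in> carrier ?S" "y \<in> carrier ?S" for x y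
    using that assms by (cases x; cases y) simp
  show "\<one>\<^bsub>?S\<^esub> \<in> carrier ?S" using assms by simp
  show "\<one>\<^bsub>?S\<^esub> \<otimes>\<^bsub>?S\<^esub> x = x" if "x \<in> carrier ?S" for x
    using that by (cases x) simp
  show "x \<otimes>\<^bsub>?S\<^esub> y \<otimes>\<^bsub>?S\<^esub> z = x \<otimes>\<^bsub>?S\<^esub> (y \<otimes>\<^bsub>?S\<^esub> z)" for x y z
  proof -
    obtain a b where x: "x = (a, b)" by force
    obtain a' b' where y: "y = (a', b')" by force
    obtain a'' b'' where z: "z = (a'', b'')" by force
    have f1: "[(a + t ^ b * a') mod int m + t ^ ((b + b') mod N) * a''
         = (a + t ^ b * a') + t ^ (b + b') * a''] (mod int m)"
      by (intro cong_add cong_mult power_mod_exponent[OF t] cong_refl) simp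
    have f2: "[a + t ^ b * ((a' + t ^ b' * a'') mod int m)
         = a + t ^ b * (a' + t ^ b' * a'')] (mod int m)"
      by (intro cong_add cong_mult cong_refl) simp
    have f3: "(a + t ^ b * a') + t ^ (b + b') * a'' = a + t ^ b * (a' + t ^ b' * a'')"
      by (simp add: algebra_simps power_add)
    have "((b + b') mod N + b'') mod N = (b + (b' + b'') mod N) mod N"
      by (simp only: mod_add_left_eq mod_add_right_eq add.assoc)
    moreover have "((a + t ^ b * a') mod int m + t ^ ((b + b') mod N) * a'') mod int m
        = (a + t ^ b * ((a' + t ^ b' * a'') mod int m)) mod int m"
      using f1 f2 unfolding f3 cong_def by (simp only:)
    ultimately show ?thesis
      by (simp only: x y z cyclic_semidirect_def monoid.simps prod.case)
  qed
  show "\<exists>y\<in>carrier ?S. y \<otimes>\<^bsub>?S\<^esub> x = \<one>\<^bsub>?S\<^esub>" if "x \<in> carrier ?S" for x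
  proof -
    obtain a b where x: "x = (a, b)" by force
    define b' where "b' = (N - b) mod N"
    have "b < N" using that by (simp add: x)
    then have b': "(b' + b) mod N = 0" "b' < N" by (simp_all add: b'_def mod_add_left_eq)
    have "((- (t ^ b' * a)) mod int m + t ^ b' * a) mod int m = 0"
      by (simp add: mod_add_left_eq)
    then show ?thesis
      using assms(1) b'
      by (intro bexI[of _ "((- (t ^ b' * a)) mod int m, b')"]) (simp_all add: x)
  qed
qed

context
  fixes n d :: nat and \<zeta> :: complex
begin

private definition D :: "int \<Rightarrow> complex mat" where
  "D k = mat_diag (n+3) (\<lambda>j. \<zeta> powi (k * (1 - int d) ^ j))"

private definition Q :: "nat \<Rightarrow> complex mat" where
  "Q b = mat (n+3) (n+3) (\<lambda>(i, j). if j = (i + b) mod (n+3) then 1 else 0)"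

private lemma carr [simp]: "D k \<in> carrier_mat (n+3) (n+3)" "Q b \<in> carrier_mat (n+3) (n+3)"
  by (simp_all add: D_def Q_def)

private lemma DQ_entry:
  "i < n+3 \<Longrightarrow> j < n+3 \<Longrightarrow>
     (D k * Q b) $$ (i, j) = (if j = (i + b) mod (n+3) then \<zeta> powi (k * (1 - int d) ^ i) else 0)"
  unfolding D_def by (subst mat_diag_mult_left[of _ "n+3" "n+3"]) (simp_all add: Q_def)

private lemma QD_entry:
  "i < n+3 \<Longrightarrow> j < n+3 \<Longrightarrow>
     (Q b * D k) $$ (i, j) = (if j = (i + b) mod (n+3) then \<zeta> powi (k * (1 - int d) ^ j) else 0)"
  unfolding D_def by (subst mat_diag_mult_right[of _ "n+3" "n+3"]) (simp_all add: Q_def)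

private lemma Q_mult: "Q b * Q c = Q (b + c)"
proof (rule eq_matI)
  fix i j assume "i < dim_row (Q (b + c))" "j < dim_col (Q (b + c))"
  then have ij: "i < n+3" "j < n+3" by (auto simp: Q_def)
  have "(Q b * Q c) $$ (i, j) =
      (\<Sum>l<n+3. if l = (i + b) mod (n+3) then (if j = (l + c) mod (n+3) then 1 else 0) else 0)"
    using ij by (auto simp: Q_def scalar_prod_def atLeast0LessThan simp del: sum.delta sum.delta' intro!: sum.cong)
  also have "\<dots> = (if j = ((i + b) mod (n+3) + c) mod (n+3) then 1 else 0)"
    by (simp add: sum.delta)
  also have "\<dots> = Q (b + c) $$ (i, j)"
    using ij by (simp add: Q_def mod_simps ac_simps)
  finally show "(Q b * Q c) $$ (i, j) = Q (b + c) $$ (i, j)" .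
qed (simp_all add: Q_def)

private lemma Q_mod: "Q (b mod (n+3)) = Q b"
  by (rule eq_matI) (simp_all add: Q_def mod_add_right_eq)

private lemma D0: "D 0 = 1\<^sub>m (n+3)" by (simp add: D_def)

private lemma Q0: "Q 0 = 1\<^sub>m (n+3)" by (rule eq_matI) (simp_all add: Q_def)

text \<open>The group generated by \<open>\<phi>\<^sub>0\<close> and \<open>\<nu>\<close> in \<open>PGL\<close> is a quotient of the semidirect product of
  \<open>Z/m\<close> and \<open>Z/(n+3)\<close>, the generators corresponding to \<open>\<phi>\<^sub>0\<close> and \<open>\<nu>\<close>. The quotient map is an
  isomorphism exactly when \<open>gcd d (n+3) = 1\<close>: otherwise a nontrivial power of the matrix of \<open>\<phi>\<^sub>0\<close>
  is scalar.\<close>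

theorem klein_group_semidirect:
  assumes d: "d \<ge> 3" and prim: "primitive_root_of_unity (klein_m n d) \<zeta>"
  defines "S \<equiv> cyclic_semidirect (klein_m n d) (n+3) (1 - int d)"
    and "P \<equiv> PGL (n+3)"
    and "\<phi> \<equiv> proj_class (n+3) (phi0_mat n d \<zeta>)"
    and "\<nu> \<equiv> proj_class (n+3) (nu_mat n)"
  defines "h \<equiv> (\<lambda>(a, b). (\<phi> [^]\<^bsub>P\<^esub> a) \<otimes>\<^bsub>P\<^esub> (\<nu> [^]\<^bsub>P\<^esub> b))"
  shows "group S" and "h \<in> hom S P" and "h ` carrier S = klein_group n d \<zeta>"
    and "inj_on h (carrier S) \<longleftrightarrow> coprime d (n+3)"
proof -
  let ?N = "n+3" and ?m = "int (klein_m n d)" and ?t = "1 - int d"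
  have m0: "klein_m n d > 0" using d by (rule klein_m_pos)
  note eq_iff = primitive_root_powi_eq_iff[OF prim m0]
  have z: "\<zeta> \<noteq> 0" using prim m0 by (auto simp: primitive_root_of_unity_def power_0_left)
  interpret P: group P unfolding P_def by (rule PGL_group)
  have tN: "[?t ^ ?N = 1] (mod ?m)"
  proof -
    have "?t ^ ?N = (-1) ^ ?N * (int d - 1) ^ ?N"
      by (simp flip: power_mult_distrib)
    also have "(int d - 1) ^ ?N = int d * ?m + (-1) ^ ?N"
      using klein_m_exact[of d n] d by simp
    also have "(-1) ^ ?N * (int d * ?m + (-1) ^ ?N) = 1 + ?m * (int d * (-1) ^ ?N)"
      by (simp add: algebra_simps flip: power_mult_distrib)
    finally have "?t ^ ?N - 1 = ?m * (int d * (-1) ^ ?N)" by simp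
    then show ?thesis by (simp only: cong_iff_dvd_diff dvd_triv_left)
  qed
  show grpS: "group S" unfolding S_def using m0 tN by (intro cyclic_semidirect_group) auto
  have D_mult: "D k * D l = D (k + l)" for k l
    using z by (simp add: D_def mat_diag_diag power_int_add algebra_simps)
  have D_cong: "D k = D l" if "[k = l] (mod ?m)" for k l
  proof -
    have "\<zeta> powi (k * ?t ^ j) = \<zeta> powi (l * ?t ^ j)" for j
      unfolding eq_iff using that by (simp add: cong_iff_dvd_diff flip: left_diff_distrib)
    then show ?thesis by (simp add: D_def)
  qed
  have QD: "Q b * D k = D (k * ?t ^ b) * Q b" for b k
  proof (rule eq_matI)
    fix i j assume "i < dim_row (D (k * ?t ^ b) * Q b)" "j < dim_col (D (k * ?t ^ b) * Q b)"
    then have ij: "i < n+3" "j < n+3" by (auto simp: Q_def D_def mat_diag_def)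
    have "\<zeta> powi (k * ?t ^ ((i + b) mod ?N)) = \<zeta> powi (k * ?t ^ b * ?t ^ i)"
      using power_mod_exponent[OF tN, of "i + b"] unfolding eq_iff
      by (simp add: cong_iff_dvd_diff power_add mult.assoc mult.commute[of "?t ^ i"]
          flip: right_diff_distrib)
    then show "(Q b * D k) $$ (i, j) = (D (k * ?t ^ b) * Q b) $$ (i, j)"
      using ij by (simp add: QD_entry DQ_entry)
  qed (auto simp: Q_def D_def mat_diag_def)
  have GL_D: "D k \<in> carrier (GL ?N)" for k
    unfolding carrier_GL by (auto intro!: bexI[of _ "D (- k)"] simp: D_mult D0)
  have GL_Q: "Q b \<in> carrier (GL ?N)" for b
  proof -
    have "Q (?N - b mod ?N) * Q b = 1\<^sub>m ?N" "Q b * Q (?N - b mod ?N) = 1\<^sub>m ?N"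
    proof -
      have "(?N - b mod ?N + b) mod ?N = (?N - b mod ?N + b mod ?N) mod ?N"
        by (rule mod_add_right_eq[symmetric])
      also have "?N - b mod ?N + b mod ?N = ?N"
        by (rule le_add_diff_inverse2) (simp add: less_imp_le)
      also have "?N mod ?N = 0" by (rule mod_self)
      finally have *: "(?N - b mod ?N + b) mod ?N = 0" .
      show "Q (?N - b mod ?N) * Q b = 1\<^sub>m ?N"
        unfolding Q_mult using Q_mod[of "?N - b mod ?N + b"] Q0 * by simp
      show "Q b * Q (?N - b mod ?N) = 1\<^sub>m ?N"
        unfolding Q_mult using Q_mod[of "b + (?N - b mod ?N)"] Q0 * by (simp add: add.commute)
    qed
    then show ?thesis unfolding carrier_GL by auto
  qed
  define cl where "cl = proj_class ?N"
  have cl_mult: "cl A \<otimes>\<^bsub>P\<^esub> cl B = cl (A * B)"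
    if "A \<in> carrier (GL ?N)" "B \<in> carrier (GL ?N)" for A B
    using that unfolding cl_def P_def by (rule proj_class_mult)
  have clP: "cl A \<in> carrier P" if "A \<in> carrier (GL ?N)" for A
    using that unfolding cl_def P_def by (rule proj_class_in_PGL)
  have cl1: "cl (1\<^sub>m ?N) = \<one>\<^bsub>P\<^esub>" unfolding cl_def P_def by (rule proj_class_one)
  have phi: "\<phi> = cl (D 1)" by (simp add: \<phi>_def cl_def D_def phi0_mat_def)
  have nu: "\<nu> = cl (Q 1)" by (simp add: \<nu>_def cl_def Q_def nu_mat_def)
  have phiP: "\<phi> \<in> carrier P" and nuP: "\<nu> \<in> carrier P" by (simp_all add: phi nu clP GL_D GL_Q)
  have nu_pow: "\<nu> [^]\<^bsub>P\<^esub> b = cl (Q b)" for b :: nat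
    by (induction b) (simp_all add: Q0 cl1 nu cl_mult GL_Q Q_mult)
  have phi_npow: "\<phi> [^]\<^bsub>P\<^esub> k = cl (D (int k))" for k :: nat
    by (induction k) (simp_all add: D0 cl1 phi cl_mult GL_D D_mult add.commute)
  have phi_pow: "\<phi> [^]\<^bsub>P\<^esub> k = cl (D k)" for k :: int
  proof (cases k rule: int_cases2)
    case (nonneg j)
    then show ?thesis by (simp only: int_pow_int phi_npow)
  next
    case (nonpos j)
    have "inv\<^bsub>P\<^esub> (\<phi> [^]\<^bsub>P\<^esub> j) = cl (D (- int j))"
      by (intro P.inv_equality) (simp_all add: phi_npow cl_mult GL_D D_mult D0 cl1 clP)
    then show ?thesis by (simp only: nonpos P.int_pow_neg_int[OF phiP])
  qed
  have h: "h (a, b) = cl (D a * Q b)" for a b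
    by (simp add: h_def phi_pow nu_pow cl_mult GL_D GL_Q)
  have GL_DQ: "D a * Q b \<in> carrier (GL ?N)" for a b
    using group.is_monoid[OF GL_group, THEN monoid.m_closed, OF GL_D GL_Q, of a b]
    by (simp add: GL_simps)
  have DQ_mult: "(D a * Q b) * (D a' * Q b') = D (a + ?t ^ b * a') * Q (b + b')" for a b a' b'
  proof -
    have "(D a * Q b) * (D a' * Q b') = D a * (Q b * (D a' * Q b'))"
      by (rule assoc_mult_mat[of _ ?N ?N _ ?N _ ?N]) (simp_all add: mult_carrier_mat[of _ ?N ?N _ ?N])
    also have "Q b * (D a' * Q b') = (Q b * D a') * Q b'"
      by (rule assoc_mult_mat[of _ ?N ?N _ ?N _ ?N, symmetric]) simp_all
    also have "\<dots> = D (a' * ?t ^ b) * (Q b * Q b')"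
      unfolding QD by (rule assoc_mult_mat[of _ ?N ?N _ ?N _ ?N]) (simp_all add: mult_carrier_mat[of _ ?N ?N _ ?N])
    also have "D a * \<dots> = (D a * D (a' * ?t ^ b)) * (Q b * Q b')"
      by (rule assoc_mult_mat[of _ ?N ?N _ ?N _ ?N, symmetric]) (simp_all add: Q_mult)
    finally show ?thesis by (simp add: D_mult Q_mult mult.commute)
  qed
  show hom: "h \<in> hom S P"
  proof (rule homI)
    show "h x \<in> carrier P" for x by (cases x) (simp add: h clP GL_DQ)
    show "h (x \<otimes>\<^bsub>S\<^esub> y) = h x \<otimes>\<^bsub>P\<^esub> h y" for x y
    proof -
      obtain a b where x: "x = (a, b)" by force
      obtain a' b' where y: "y = (a', b')" by force
      have "D ((a + ?t ^ b * a') mod ?m) = D (a + ?t ^ b * a')" by (rule D_cong) simp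
      then show ?thesis
        by (simp add: x y h S_def cyclic_semidirect_def cl_mult GL_DQ DQ_mult Q_mod)
    qed
  qed
  interpret h: group_hom S P h
    using grpS hom by (simp add: group_hom_def group_hom_axioms_def P.is_group)
  have red: "h (a, b) \<in> h ` carrier S" for a b
  proof -
    have "h (a, b) = h (a mod ?m, b mod ?N)"
      unfolding h Q_mod using D_cong[of "a mod ?m" a] by simp
    moreover have "(a mod ?m, b mod ?N) \<in> carrier S"
      using m0 by (simp add: S_def cyclic_semidirect_def)
    ultimately show ?thesis by simp
  qed
  have phi_h: "\<phi> = h (1, 0)" and nu_h: "\<nu> = h (0, 1)"
    by (simp_all add: h phi nu Q0 D0 right_mult_one_mat[of _ ?N ?N] left_mult_one_mat[of _ ?N ?N])
  have sub: "subgroup (h ` carrier S) P" by (rule h.img_is_subgroup)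
  show "h ` carrier S = klein_group n d \<zeta>"
  proof
    show "klein_group n d \<zeta> \<subseteq> h ` carrier S"
      unfolding klein_group_def P_def[symmetric] \<phi>_def[symmetric] \<nu>_def[symmetric]
      by (rule P.generate_subgroup_incl[OF _ sub]) (auto simp: phi_h nu_h red)
    have gen: "subgroup (generate P {\<phi>, \<nu>}) P"
      by (rule P.generate_is_subgroup) (simp add: phiP nuP)
    have "h (a, b) \<in> generate P {\<phi>, \<nu>}" for a b
    proof -
      have "\<phi> [^]\<^bsub>P\<^esub> a \<in> generate P {\<phi>, \<nu>}" "\<nu> [^]\<^bsub>P\<^esub> int b \<in> generate P {\<phi>, \<nu>}"
        by (intro P.subgroup_int_pow_closed[OF gen] generate.incl; simp)+
      then show ?thesis
        unfolding h_def prod.case int_pow_int by (rule subgroup.m_closed[OF gen])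
    qed
    then show "h ` carrier S \<subseteq> klein_group n d \<zeta>"
      unfolding klein_group_def P_def[symmetric] \<phi>_def[symmetric] \<nu>_def[symmetric] by auto
  qed
  have cl_eq1: "cl A = \<one>\<^bsub>P\<^esub> \<longleftrightarrow> (\<exists>c. c \<noteq> 0 \<and> A = c \<cdot>\<^sub>m 1\<^sub>m ?N)"
    if A: "A \<in> carrier_mat ?N ?N" for A
  proof
    assume *: "cl A = \<one>\<^bsub>P\<^esub>"
    have "A \<in> cl A" unfolding cl_def proj_class_eq[OF A] by (auto intro!: exI[of _ 1])
    then show "\<exists>c. c \<noteq> 0 \<and> A = c \<cdot>\<^sub>m 1\<^sub>m ?N"
      unfolding * by (auto simp: P_def PGL_def scalar_mats_def)
  next
    assume "\<exists>c. c \<noteq> 0 \<and> A = c \<cdot>\<^sub>m 1\<^sub>m ?N"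
    then obtain c where c: "c \<noteq> 0" "A = c \<cdot>\<^sub>m 1\<^sub>m ?N" by auto
    then have "A \<in> scalar_mats ?N" by (auto simp: scalar_mats_def)
    then have "scalar_mats ?N #>\<^bsub>GL ?N\<^esub> A = scalar_mats ?N"
      using group.coset_join2[OF GL_group] scalar_mats_sub[of ?N]
        normal_imp_subgroup[OF scalar_mats_normal, of ?N] by blast
    then show "cl A = \<one>\<^bsub>P\<^esub>" by (simp add: cl_def proj_class_def P_def PGL_def)
  qed
  show "inj_on h (carrier S) \<longleftrightarrow> coprime d (n+3)"
  proof
    assume cop: "coprime d (n+3)"
    then have cop': "coprime ?m (int d)"
      using gcd_klein_m[of d n] d by (simp add: coprime_iff_gcd_eq_1)
    show "inj_on h (carrier S)"
      unfolding h.inj_iff_trivial_ker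
    proof (intro equalityI subsetI)
      fix x assume "x \<in> kernel S P h"
      then have x': "x \<in> carrier S" "h x = \<one>\<^bsub>P\<^esub>" by (auto simp: kernel_def)
      obtain a b where x: "x = (a, b)" by force
      have ab: "0 \<le> a" "a < ?m" "b < ?N" using x' by (auto simp: x S_def cyclic_semidirect_def)
      have "D a * Q b \<in> carrier_mat ?N ?N" by (intro mult_carrier_mat[of _ _ ?N]) auto
      then obtain c where c: "c \<noteq> 0" "D a * Q b = c \<cdot>\<^sub>m 1\<^sub>m ?N"
        using x' cl_eq1 by (auto simp: x h)
      have "(D a * Q b) $$ (0, 0) = c" by (simp add: c)
      then have b: "b = 0" using c(1) ab DQ_entry[of 0 0 a b] by (auto split: if_splits)
      have "(D a * Q b) $$ (0, 0) = (D a * Q b) $$ (1, 1)" by (simp add: c)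
      then have "\<zeta> powi a = \<zeta> powi (a * ?t)" by (simp add: DQ_entry b)
      then have "?m dvd a * int d" by (simp add: eq_iff algebra_simps)
      then have "?m dvd a" using cop' by (simp add: coprime_dvd_mult_left_iff)
      then have "a = 0" using ab zdvd_not_zless by force
      then show "x \<in> {\<one>\<^bsub>S\<^esub>}" by (simp add: x b S_def cyclic_semidirect_def)
    qed (auto simp: kernel_def)
  next
    assume inj: "inj_on h (carrier S)"
    show "coprime d (n+3)"
    proof (rule ccontr)
      define g where "g = gcd (klein_m n d) d"
      assume "\<not> coprime d (n+3)"
      then have g1: "g \<noteq> 1" using gcd_klein_m[of d n] d by (simp add: g_def coprime_iff_gcd_eq_1)
      have g0: "g > 0" using m0 by (simp add: g_def)
      obtain q where q: "klein_m n d = g * q" using gcd_dvd1 unfolding g_def by (metis dvd_def)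
      obtain e where e: "d = g * e" using gcd_dvd2 unfolding g_def by (metis dvd_def)
      have q0: "0 < q" and qm: "q < klein_m n d" using q m0 g0 g1 by (cases g; auto)+
      have "\<zeta> powi (int q * ?t ^ i) = \<zeta> powi int q" for i
      proof -
        have "int d dvd ?t ^ i - 1"
        proof -
          have "[?t ^ i = 1 ^ i] (mod int d)" by (intro cong_pow) (simp add: cong_iff_dvd_diff)
          then show ?thesis by (simp add: cong_iff_dvd_diff)
        qed
        then obtain r where "?t ^ i - 1 = int d * r" by (auto simp: dvd_def)
        then have "int q * (?t ^ i - 1) = int q * (int d * r)" by simp
        also have "\<dots> = int q * ((int g * int e) * r)"
          using arg_cong[OF e, of int] by (simp only: of_nat_mult)
        also have "\<dots> = (int g * int q) * (int e * r)" by (simp only: mult_ac)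
        also have "int g * int q = ?m" using arg_cong[OF q, of int] by (simp only: of_nat_mult)
        finally show ?thesis unfolding eq_iff by (simp add: right_diff_distrib)
      qed
      then have "D (int q) = \<zeta> powi int q \<cdot>\<^sub>m 1\<^sub>m ?N"
        by (intro eq_matI) (simp_all add: D_def mat_diag_def)
      moreover have "\<zeta> powi int q \<noteq> 0" using z by (rule power_int_not_zero[OF disjI1])
      ultimately have "cl (D (int q)) = \<one>\<^bsub>P\<^esub>" using cl_eq1[OF carr(1)] by blast
      then have "h (int q, 0) = h (0, 0)" by (simp add: h Q0 D0 cl1 right_mult_one_mat[of _ ?N ?N])
      moreover have "(int q, 0) \<in> carrier S" "(0, 0) \<in> carrier S"
        using qm m0 by (auto simp: S_def cyclic_semidirect_def)
      ultimately have "(int q, 0 :: nat) = (0, 0)" using inj by (blast dest: inj_onD)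
      then show False using q0 by simp
    qed
  qed
qed

end

end

theory Submission
  imports Defs "Jordan_Normal_Form.Determinant"
begin

text \<open>With \<open>t = 1 - d\<close> one has \<open>t ^ (n+3) = 1\<close> modulo \<open>m\<close>, so the weights \<open>t ^ j\<close> of \<open>\<phi>\<^sub>0\<close> depend
  only on \<open>j\<close> modulo \<open>n+3\<close>. Every monomial of \<open>K\<close> then has weight \<open>(d-1) t ^ j + t ^ (j+1) = 0\<close>, and
  every monomial of \<open>K'\<close> has weight \<open>(d'-1) t ^ (j+1) + t ^ j = t ^ j (1 - (d-1) (d'-1)) = 0\<close>
  modulo \<open>m\<close>. Hence \<open>\<phi>\<^sub>0\<close> and \<open>\<nu>\<close> fix both forms. If \<open>d' \<le> d\<close>, then \<open>m\<close> divides the positive number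
  \<open>(d-1) (d'-1) - 1 \<le> d (d-2)\<close>, which is impossible because \<open>d m \<ge> (d-1) ^ 4 - 1\<close>.\<close>

section \<open>The action of PGL on points and the stabilizer of a set of points\<close>

lemma mult_mat_vec_eq_0_GL:
  assumes "A \<in> carrier (GL N)" "x \<in> carrier_vec N" "A *\<^sub>v x = 0\<^sub>v N"
  shows "x = 0\<^sub>v N"
proof -
  obtain B where B: "B \<in> carrier_mat N N" "B * A = 1\<^sub>m N" and A: "A \<in> carrier_mat N N"
    using assms(1) by (auto simp: carrier_GL)
  have "x = (B * A) *\<^sub>v x" using B assms(2) by simp
  also have "\<dots> = B *\<^sub>v (A *\<^sub>v x)" using A B assms(2) by (intro assoc_mult_mat_vec)
  also have "\<dots> = 0\<^sub>v N" using assms(3) B by auto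
  finally show ?thesis .
qed

lemma PGL_carrierE:
  assumes "g \<in> carrier (PGL N)"
  obtains A where "A \<in> carrier (GL N)" "g = proj_class N A"
  using assms by (auto simp: PGL_def carrier_FactGroup proj_class_def)

lemma proj_act_mult:
  assumes "g \<in> carrier (PGL N)" "h \<in> carrier (PGL N)" "p \<in> proj_space N"
  shows "proj_act (g \<otimes>\<^bsub>PGL N\<^esub> h) p = proj_act g (proj_act h p)"
proof -
  obtain A where A: "A \<in> carrier (GL N)" "g = proj_class N A" using assms(1) by (rule PGL_carrierE)
  obtain B where B: "B \<in> carrier (GL N)" "h = proj_class N B" using assms(2) by (rule PGL_carrierE)
  obtain x where x: "x \<in> carrier_vec N" "p = proj_point x"
    using assms(3) by (auto simp: proj_space_def)
  have AB: "A \<in> carrier_mat N N" "B \<in> carrier_mat N N" using A B by (auto simp: carrier_GL)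
  show ?thesis
    using AB x unfolding A(2) B(2) proj_class_mult[OF A(1) B(1)]
    by (simp add: proj_act_class[of _ N] mult_carrier_mat[of _ N N] mult_mat_vec_carrier[of _ N N])
qed

lemma proj_act_one:
  assumes "p \<in> proj_space N"
  shows "proj_act \<one>\<^bsub>PGL N\<^esub> p = p"
  using assms by (auto simp: proj_space_def proj_class_one[symmetric] proj_act_class)

lemma subgroup_proj_Aut:
  assumes "X \<subseteq> proj_space N"
  shows "subgroup (proj_Aut N X) (PGL N)"
proof -
  interpret P: group "PGL N" by (rule PGL_group)
  have mult: "proj_act (g \<otimes>\<^bsub>PGL N\<^esub> h) ` X = proj_act g ` proj_act h ` X"
    if "g \<in> carrier (PGL N)" "h \<in> carrier (PGL N)" for g h
    using proj_act_mult[OF that] assms unfolding image_image by (intro image_cong) auto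
  have one: "proj_act \<one>\<^bsub>PGL N\<^esub> ` X = X"
    using proj_act_one assms by (force intro: image_eqI)
  show ?thesis
  proof (rule P.subgroupI)
    show "proj_Aut N X \<noteq> {}" using one by (auto simp: proj_Aut_def)
    show "inv\<^bsub>PGL N\<^esub> g \<in> proj_Aut N X" if "g \<in> proj_Aut N X" for g
    proof -
      have g: "g \<in> carrier (PGL N)" "proj_act g ` X = X" using that by (auto simp: proj_Aut_def)
      have "proj_act (inv\<^bsub>PGL N\<^esub> g) ` X = proj_act (inv\<^bsub>PGL N\<^esub> g) ` proj_act g ` X"
        by (simp only: g)
      also have "\<dots> = X" using g mult[of "inv\<^bsub>PGL N\<^esub> g" g] one by simp
      finally show ?thesis using g by (simp add: proj_Aut_def)
    qed
  qed (auto simp: proj_Aut_def mult)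
qed

text \<open>A point of the zero locus has \<open>F\<close> vanishing on all its representatives, and
  scalars commute with the matrix, so invariance carries each of them over. This gives one
  inclusion; the other comes from the inverse matrix, which fixes \<open>F\<close> as well.\<close>

lemma proj_class_in_proj_Aut:
  assumes A: "A \<in> carrier (GL N)"
    and inv: "\<And>x. x \<in> carrier_vec N \<Longrightarrow> F (A *\<^sub>v x) = F x"
  shows "proj_class N A \<in> proj_Aut N (zero_locus N F)"
proof -
  \<comment> \<open>Stated for an arbitrary \<open>C\<close>, since it is applied both to
    \<open>A\<close> and to its inverse \<open>B\<close>.\<close>
  have maps: "proj_act (proj_class N C) p \<in> zero_locus N F"
    if C: "C \<in> carrier (GL N)" and invC: "\<And>x. x \<in> carrier_vec N \<Longrightarrow> F (C *\<^sub>v x) = F x"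
      and p: "p \<in> zero_locus N F" for C p
  proof -
    have C': "C \<in> carrier_mat N N" using C by (simp add: carrier_GL)
    obtain x where x: "x \<in> carrier_vec N" "x \<noteq> 0\<^sub>v N" "p = proj_point x"
      using p by (auto simp: zero_locus_def proj_space_def)
    have "C *\<^sub>v x \<in> carrier_vec N - {0\<^sub>v N}"
      using C' mult_mat_vec_eq_0_GL[OF C x(1)] x by auto
    moreover have "F (c \<cdot>\<^sub>v (C *\<^sub>v x)) = 0" if "c \<noteq> 0" for c
    proof -
      have "F (c \<cdot>\<^sub>v (C *\<^sub>v x)) = F (C *\<^sub>v (c \<cdot>\<^sub>v x))"
        using C' x by (simp add: mult_mat_vec[of _ N N])
      also have "\<dots> = F (c \<cdot>\<^sub>v x)" using x by (intro invC) simp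
      also have "\<dots> = 0" using p that x by (auto simp: zero_locus_def proj_point_def)
      finally show ?thesis .
    qed
    ultimately show ?thesis
      unfolding x(3) proj_act_class[OF C' x(1)]
      by (auto simp: zero_locus_def proj_space_def proj_point_def)
  qed
  obtain B where B: "B \<in> carrier_mat N N" "B * A = 1\<^sub>m N" "A * B = 1\<^sub>m N"
    using A by (auto simp: carrier_GL)
  have A': "A \<in> carrier_mat N N" using A by (simp add: carrier_GL)
  have BG: "B \<in> carrier (GL N)" using B A' by (auto simp: carrier_GL)
  have invB: "F (B *\<^sub>v x) = F x" if x: "x \<in> carrier_vec N" for x
  proof -
    have "F (B *\<^sub>v x) = F (A *\<^sub>v (B *\<^sub>v x))" using B x by (intro inv[symmetric]) auto
    also have "A *\<^sub>v (B *\<^sub>v x) = (A * B) *\<^sub>v x"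
      using A' B x by (intro assoc_mult_mat_vec[symmetric])
    finally show ?thesis using B x by simp
  qed
  have "p \<in> proj_act (proj_class N A) ` zero_locus N F" if p: "p \<in> zero_locus N F" for p
  proof (rule image_eqI)
    show "proj_act (proj_class N B) p \<in> zero_locus N F" by (rule maps[OF BG invB p])
    have "p \<in> proj_space N" using p by (simp add: zero_locus_def)
    then show "p = proj_act (proj_class N A) (proj_act (proj_class N B) p)"
      using proj_act_mult[OF proj_class_in_PGL[OF A] proj_class_in_PGL[OF BG]]
      by (simp add: proj_class_mult[OF A BG] B proj_class_one proj_act_one)
  qed
  then show ?thesis
    using maps[OF A inv] proj_class_in_PGL[OF A] by (auto simp: proj_Aut_def)
qed

section \<open>Diagonal matrices and the cyclic permutation matrix\<close>

lemma mat_diag_in_GL: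
  assumes "\<And>i. i < N \<Longrightarrow> f i \<noteq> 0"
  shows "mat_diag N f \<in> carrier (GL N)"
proof -
  have "mat_diag N (\<lambda>i. inverse (f i) * f i) = 1\<^sub>m N"
    using assms by (intro eq_matI) (auto simp: mat_diag_def)
  then show ?thesis
    unfolding carrier_GL
    by (auto intro!: bexI[of _ "mat_diag N (\<lambda>i. inverse (f i))"] simp: mat_diag_diag mult.commute)
qed

lemma mat_diag_mult_vec:
  assumes "x \<in> carrier_vec N"
  shows "mat_diag N f *\<^sub>v x = vec N (\<lambda>i. f i * x $ i)"
  using assms
  by (auto intro!: eq_vecI simp: mat_diag_def scalar_prod_def if_distrib[of "\<lambda>c. c * _"] sum.delta
      cong: if_cong)

lemma nu_mat_in_GL: "nu_mat n \<in> carrier (GL (n+3))"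
proof -
  let ?N = "n+3"
  \<comment> \<open>The transpose of \<open>nu_mat n\<close>, which is the backward shift. Only one
    product is computed; for square matrices over a field a one-sided inverse is two-sided.\<close>
  define B :: "complex mat" where
    "B = mat ?N ?N (\<lambda>(i, j). if i = (j + 1) mod ?N then 1 else 0)"
  have Bc: "B \<in> carrier_mat ?N ?N" and Ac: "nu_mat n \<in> carrier_mat ?N ?N"
    by (simp_all add: B_def nu_mat_def)
  have inj: "(i + 1) mod ?N = (j + 1) mod ?N \<longleftrightarrow> i = j" if "i < ?N" "j < ?N" for i j
    using that by (auto simp: mod_Suc split: if_splits)
  have AB: "nu_mat n * B = 1\<^sub>m ?N"
  proof (rule eq_matI)
    fix i j assume "i < dim_row (1\<^sub>m ?N)" "j < dim_col (1\<^sub>m ?N)"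
    then have ij: "i < ?N" "j < ?N" by simp_all
    have "(nu_mat n * B) $$ (i, j) = (nu_mat n *\<^sub>v col B j) $ i"
      using ij Bc Ac by simp
    also have "\<dots> = col B j $ ((i + 1) mod ?N)"
      using ij Bc by (subst nu_mat_apply) auto
    also have "\<dots> = 1\<^sub>m ?N $$ (i, j)"
      using ij inj[OF ij] by (simp add: B_def)
    finally show "(nu_mat n * B) $$ (i, j) = 1\<^sub>m ?N $$ (i, j)" .
  qed (use Ac Bc in auto)
  then show ?thesis
    using mat_mult_left_right_inverse[OF Ac Bc AB] Ac Bc unfolding carrier_GL by auto
qed

section \<open>Both forms as cyclic sums, and their invariance\<close>

lemma sum_cyclic_shift:
  fixes f :: "nat \<Rightarrow> 'a::comm_monoid_add"
  shows "(\<Sum>i<N. f ((i + 1) mod N)) = sum f {..<N}"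
proof (cases N)
  case (Suc M)
  have "(\<Sum>i<N. f ((i + 1) mod N)) = (\<Sum>i<M. f (Suc i)) + f 0"
    by (simp add: Suc)
  also have "\<dots> = sum f {..<N}"
    unfolding Suc by (subst sum.lessThan_Suc_shift) (rule add.commute)
  finally show ?thesis .
qed simp

text \<open>The separate last term is the summand \<open>i = n+2\<close>, whose successor wraps
  around to \<open>0\<close>. With uniform indices, \<nu> merely shifts the summation and a diagonal
  matrix can be checked on one generic monomial.\<close>

lemma klein_form_cyclic:
  "klein_form n d x = (\<Sum>i<n+3. (x $ i) ^ (d - 1) * x $ ((i + 1) mod (n+3)))"
proof -
  have "n + 3 = Suc (n + 2)" by simp
  then show ?thesis
    unfolding klein_form_def by (simp only: sum.lessThan_Suc) (auto intro!: arg_cong2[of _ _ _ _ "(+)"] sum.cong)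
qed

lemma rev_klein_form_cyclic:
  "rev_klein_form n d x = (\<Sum>i<n+3. (x $ ((i + 1) mod (n+3))) ^ (d - 1) * x $ i)"
proof -
  have "n + 3 = Suc (n + 2)" by simp
  then show ?thesis
    unfolding rev_klein_form_def by (simp only: sum.lessThan_Suc) (auto intro!: arg_cong2[of _ _ _ _ "(+)"] sum.cong)
qed

lemma forms_nu_mat:
  assumes "x \<in> carrier_vec (n+3)"
  shows "klein_form n d (nu_mat n *\<^sub>v x) = klein_form n d x"
    and "rev_klein_form n d (nu_mat n *\<^sub>v x) = rev_klein_form n d x"
  unfolding nu_mat_apply[OF assms] klein_form_cyclic rev_klein_form_cyclic
  using sum_cyclic_shift[of "\<lambda>i. (x $ i) ^ (d - 1) * x $ ((i + 1) mod (n+3))" "n+3"]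
    sum_cyclic_shift[of "\<lambda>i. (x $ ((i + 1) mod (n+3))) ^ (d - 1) * x $ i" "n+3"]
  by simp_all

text \<open>A diagonal matrix multiplies each monomial by the same monomial evaluated at its
  diagonal entries; the hypotheses say that all these factors are 1.\<close>

lemma forms_mat_diag:
  assumes x: "x \<in> carrier_vec (n+3)"
  shows "(\<And>i. i < n+3 \<Longrightarrow> f i ^ (d - 1) * f ((i + 1) mod (n+3)) = 1) \<Longrightarrow>
      klein_form n d (mat_diag (n+3) f *\<^sub>v x) = klein_form n d x"
    and "(\<And>i. i < n+3 \<Longrightarrow> f ((i + 1) mod (n+3)) ^ (d - 1) * f i = 1) \<Longrightarrow>
      rev_klein_form n d (mat_diag (n+3) f *\<^sub>v x) = rev_klein_form n d x"
proof -
  let ?s = "\<lambda>i. (i + 1) mod (n+3)"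
  assume f: "\<And>i. i < n+3 \<Longrightarrow> f i ^ (d - 1) * f (?s i) = 1"
  have "(f i * x $ i) ^ (d - 1) * (f (?s i) * x $ ?s i) = (x $ i) ^ (d - 1) * x $ ?s i"
    if "i < n+3" for i
  proof -
    have "(f i * x $ i) ^ (d - 1) * (f (?s i) * x $ ?s i)
        = (f i ^ (d - 1) * f (?s i)) * ((x $ i) ^ (d - 1) * x $ ?s i)"
      by (simp only: power_mult_distrib mult_ac)
    then show ?thesis by (simp only: f[OF that] mult_1)
  qed
  then show "klein_form n d (mat_diag (n+3) f *\<^sub>v x) = klein_form n d x"
    unfolding mat_diag_mult_vec[OF x] klein_form_cyclic by (intro sum.cong) simp_all
next
  let ?s = "\<lambda>i. (i + 1) mod (n+3)"
  assume f: "\<And>i. i < n+3 \<Longrightarrow> f (?s i) ^ (d - 1) * f i = 1"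
  have "(f (?s i) * x $ ?s i) ^ (d - 1) * (f i * x $ i) = (x $ ?s i) ^ (d - 1) * x $ i"
    if "i < n+3" for i
  proof -
    have "(f (?s i) * x $ ?s i) ^ (d - 1) * (f i * x $ i)
        = (f (?s i) ^ (d - 1) * f i) * ((x $ ?s i) ^ (d - 1) * x $ i)"
      by (simp only: power_mult_distrib mult_ac)
    then show ?thesis by (simp only: f[OF that] mult_1)
  qed
  then show "rev_klein_form n d (mat_diag (n+3) f *\<^sub>v x) = rev_klein_form n d x"
    unfolding mat_diag_mult_vec[OF x] rev_klein_form_cyclic by (intro sum.cong) simp_all
qed

section \<open>Weights of \<open>phi0_mat\<close> modulo m\<close>

text \<open>Multiply the defining identity \<open>d * m = (d-1)^(n+3) - (-1)^(n+3)\<close> by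
  \<open>(-1)^(n+3)\<close>, whose square is 1.\<close>

lemma one_minus_power_cong_klein_m:
  assumes "d \<ge> 2"
  shows "[(1 - int d) ^ (n+3) = 1] (mod int (klein_m n d))"
proof -
  have "(1 - int d) ^ (n+3) = (-1) ^ (n+3) * (int d - 1) ^ (n+3)"
    by (simp flip: power_mult_distrib)
  also have "(int d - 1) ^ (n+3) = int d * int (klein_m n d) + (-1) ^ (n+3)"
    using klein_m_exact[OF assms, of n] by simp
  also have "(-1) ^ (n+3) * (int d * int (klein_m n d) + (-1) ^ (n+3))
      = 1 + int (klein_m n d) * (int d * (-1) ^ (n+3))"
    by (simp add: algebra_simps flip: power_mult_distrib)
  finally have "(1 - int d) ^ (n+3) - 1 = int (klein_m n d) * (int d * (-1) ^ (n+3))" by simp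
  then show ?thesis by (simp only: cong_iff_dvd_diff dvd_triv_left)
qed

lemma phi0_mat_in_GL: "\<zeta> \<noteq> 0 \<Longrightarrow> phi0_mat n d \<zeta> \<in> carrier (GL (n+3))"
  unfolding phi0_mat_def by (rule mat_diag_in_GL) simp

lemma forms_phi0_mat:
  assumes d: "d \<ge> 3" and prim: "primitive_root_of_unity (klein_m n d) \<zeta>"
    and x: "x \<in> carrier_vec (n+3)"
  shows "klein_form n d (phi0_mat n d \<zeta> *\<^sub>v x) = klein_form n d x"
    and "d' \<ge> 1 \<Longrightarrow> [(d - 1) * (d' - 1) = 1] (mod klein_m n d) \<Longrightarrow>
      rev_klein_form n d' (phi0_mat n d \<zeta> *\<^sub>v x) = rev_klein_form n d' x"
proof -
  let ?m = "int (klein_m n d)" and ?t = "1 - int d"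
  have m0: "klein_m n d > 0" using d by (rule klein_m_pos)
  have z: "\<zeta> \<noteq> 0" using prim m0 by (auto simp: primitive_root_of_unity_def power_0_left)
  note eq_iff = primitive_root_powi_eq_iff[OF prim m0]
  \<comment> \<open>Periodicity of the weights matters for \<open>i = n+2\<close>, where the
    exponent on the left is \<open>?t ^ 0\<close> and not \<open>?t ^ (n+3)\<close>.\<close>
  have next_weight: "\<zeta> powi (?t ^ ((i + 1) mod (n+3))) = \<zeta> powi (?t ^ i * ?t)" for i
    using power_mod_exponent[OF one_minus_power_cong_klein_m[of d n], of "i + 1"] d
    unfolding eq_iff by (simp add: cong_iff_dvd_diff mult.commute)
  have pow: "(\<zeta> powi a) ^ k * \<zeta> powi b = \<zeta> powi (int k * a + b)" for a b k
    using z by (simp add: power_int_add power_int_mult mult.commute[of "int k"])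
  show "klein_form n d (phi0_mat n d \<zeta> *\<^sub>v x) = klein_form n d x"
    unfolding phi0_mat_def
  proof (rule forms_mat_diag(1)[OF x])
    fix i
    \<comment> \<open>Once the wrap-around is absorbed, the weight for \<open>K\<close> vanishes as
      an integer; for \<open>K'\<close> below it vanishes only modulo m, by the hypothesis on
      \<open>d'\<close>.\<close>
    have "int (d - 1) * ?t ^ i + ?t ^ i * ?t = 0"
      using d by (simp add: of_nat_diff algebra_simps)
    then show "(\<zeta> powi ?t ^ i) ^ (d - 1) * \<zeta> powi ?t ^ ((i + 1) mod (n+3)) = 1"
      unfolding next_weight pow by simp
  qed
  assume d': "d' \<ge> 1" and cong: "[(d - 1) * (d' - 1) = 1] (mod klein_m n d)"
  have "[int ((d - 1) * (d' - 1)) = int 1] (mod ?m)" using cong by (simp only: cong_int_iff)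
  then have dvd: "?m dvd int (d - 1) * int (d' - 1) - 1" by (simp add: cong_iff_dvd_diff)
  show "rev_klein_form n d' (phi0_mat n d \<zeta> *\<^sub>v x) = rev_klein_form n d' x"
    unfolding phi0_mat_def
  proof (rule forms_mat_diag(2)[OF x])
    fix i
    \<comment> \<open>The term \<open>- 0\<close> gives the difference the shape that
      \<open>eq_iff\<close> expects when comparing with \<zeta> to the power 0.\<close>
    have "int (d' - 1) * (?t ^ i * ?t) + ?t ^ i - 0
        = (int (d - 1) * int (d' - 1) - 1) * (- (?t ^ i))"
      using d d' by (simp add: of_nat_diff algebra_simps)
    then have "?m dvd int (d' - 1) * (?t ^ i * ?t) + ?t ^ i - 0"
      using dvd by (simp only: dvd_mult2)
    then have "\<zeta> powi (int (d' - 1) * (?t ^ i * ?t) + ?t ^ i) = \<zeta> powi 0"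
      unfolding eq_iff .
    then show "(\<zeta> powi ?t ^ ((i + 1) mod (n+3))) ^ (d' - 1) * \<zeta> powi ?t ^ i = 1"
      unfolding next_weight pow by simp
  qed
qed

section \<open>The inequality between the degrees\<close>

text \<open>Put \<open>e = d - 1\<close>. Since \<open>n \<ge> 1\<close>, the left side is at least
  \<open>e^4 - 1 = (e+1)(e-1)(e^2+1)\<close>, while the right side is
  \<open>(e+1)(e-1)(e+1)\<close>; they differ by \<open>(e+1)(e-1) * e(e-1) > 0\<close>. The common
  factor \<open>d\<close> avoids dividing in the definition of m.\<close>

lemma klein_m_lower_bound:
  assumes "n \<ge> 1" "d \<ge> 3"
  shows "int d * int (klein_m n d) > int d * (int d * (int d - 2))"
proof -
  define e where "e = int d - 1"
  have e: "e \<ge> 2" "int d = e + 1" using assms by (auto simp: e_def)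
  have "(-1 :: int) ^ (n+3) \<le> 1" by (cases "even (n+3)") simp_all
  moreover have "e ^ 4 \<le> e ^ (n+3)" using assms e by (intro power_increasing) auto
  ultimately have "int d * int (klein_m n d) \<ge> e ^ 4 - 1"
    using klein_m_exact[of d n] assms unfolding e_def by linarith
  also have "e ^ 4 - 1 = (e + 1) * ((e + 1) * (e - 1)) + (e + 1) * (e - 1) * (e * (e - 1))"
    by (simp add: algebra_simps eval_nat_numeral)
  moreover have "(e + 1) * (e - 1) * (e * (e - 1)) > 0" using e by simp
  ultimately show ?thesis by (simp add: e)
qed

lemma inverse_degree_greater:
  assumes "n \<ge> 1" "d \<ge> 3" "d' \<ge> 2"
    and cong: "[(d - 1) * (d' - 1) = 1] (mod klein_m n d)"
  shows "d' > d"
proof (rule ccontr)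
  assume "\<not> d' > d"
  then have le: "d' \<le> d" by simp
  have "[int ((d - 1) * (d' - 1)) = int 1] (mod int (klein_m n d))"
    using cong by (simp only: cong_int_iff)
  then have "int (klein_m n d) dvd (int d - 1) * (int d' - 1) - 1"
    using assms by (simp add: cong_iff_dvd_diff of_nat_diff)
  \<comment> \<open>Positivity turns divisibility by m into an upper bound on m; it uses
    \<open>d - 1 \<ge> 2\<close> and \<open>d' - 1 \<ge> 1\<close>.\<close>
  moreover have "(int d - 1) * (int d' - 1) - 1 > 0"
  proof -
    have "1 < (int d - 1) * 1" using assms by simp
    also have "\<dots> \<le> (int d - 1) * (int d' - 1)" using assms by (intro mult_left_mono) auto
    finally show ?thesis by simp
  qed
  ultimately have "int (klein_m n d) \<le> (int d - 1) * (int d' - 1) - 1" by (rule zdvd_imp_le)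
  also have "\<dots> \<le> (int d - 1) * (int d - 1) - 1"
    using le assms by (intro diff_right_mono mult_left_mono) auto
  also have "\<dots> = int d * (int d - 2)" by (simp add: algebra_simps)
  finally have "int d * int (klein_m n d) \<le> int d * (int d * (int d - 2))"
    by (intro mult_left_mono) auto
  then show False using klein_m_lower_bound[OF assms(1,2)] by linarith
qed

section \<open>From the two generators to the whole group\<close>

lemma klein_group_subset_proj_Aut:
  assumes "\<zeta> \<noteq> 0"
    and "\<And>x. x \<in> carrier_vec (n+3) \<Longrightarrow> F (phi0_mat n d \<zeta> *\<^sub>v x) = F x"
    and "\<And>x. x \<in> carrier_vec (n+3) \<Longrightarrow> F (nu_mat n *\<^sub>v x) = F x"
  shows "klein_group n d \<zeta> \<subseteq> proj_Aut (n+3) (zero_locus (n+3) F)"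
  unfolding klein_group_def
proof (rule group.generate_subgroup_incl[OF PGL_group])
  show "{proj_class (n+3) (phi0_mat n d \<zeta>), proj_class (n+3) (nu_mat n)}
      \<subseteq> proj_Aut (n+3) (zero_locus (n+3) F)"
    using assms by (simp add: proj_class_in_proj_Aut phi0_mat_in_GL nu_mat_in_GL)
  show "subgroup (proj_Aut (n+3) (zero_locus (n+3) F)) (PGL (n+3))"
    by (rule subgroup_proj_Aut) (auto simp: zero_locus_def)
qed

theorem proposition4p4:
  fixes n d d' :: nat and \<zeta> :: complex
  assumes "n \<ge> 1" and "d \<ge> 3" and "d' \<ge> 2"
    and "primitive_root_of_unity (klein_m n d) \<zeta>"
    and "[(d - 1) * (d' - 1) = 1] (mod klein_m n d)"
  shows "d' > d \<and>
    klein_group n d \<zeta> \<subseteq>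
      proj_Aut (n+3) (klein_hypersurface n d) \<inter> proj_Aut (n+3) (rev_klein_hypersurface n d')"
proof -
  have z: "\<zeta> \<noteq> 0"
    using assms(4) klein_m_pos[OF assms(2), of n]
    by (auto simp: primitive_root_of_unity_def power_0_left)
  have "klein_group n d \<zeta> \<subseteq> proj_Aut (n+3) (klein_hypersurface n d)"
    unfolding klein_hypersurface_def using z
    by (rule klein_group_subset_proj_Aut) (simp_all add: forms_phi0_mat(1) forms_nu_mat(1) assms)
  moreover have "klein_group n d \<zeta> \<subseteq> proj_Aut (n+3) (rev_klein_hypersurface n d')"
    unfolding rev_klein_hypersurface_def
  proof (rule klein_group_subset_proj_Aut[OF z])
    show "rev_klein_form n d' (phi0_mat n d \<zeta> *\<^sub>v x) = rev_klein_form n d' x"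
      if "x \<in> carrier_vec (n+3)" for x
      using assms that by (intro forms_phi0_mat(2)) auto
  qed (rule forms_nu_mat(2))
  ultimately show ?thesis using inverse_degree_greater[OF assms(1-3,5)] by simp
qed

end
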